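(* Let $n\ge 2$ and $d=n-1$. Then there exists an effectively constructible sequence $(\boldsymbol{u}_k)_{k\ge 1}$ of points of the unit sphere $\mathbb{S}^d\subset\mathbb{R}^n$ such that the spiral set $\{\sqrt[n]{k}\,\boldsymbol{u}_k\}_{k\ge 1}$ is a Delone set in $\mathbb{R}^n$.
   Context: A set $\mathfrak{B}\subset\mathbb{R}^n$ is uniformly discrete if $\inf\{\|\boldsymbol{x}-\boldsymbol{y}\|_2:\boldsymbol{x},\boldsymbol{y}\in\mathfrak{B},\ \boldsymbol{x}\neq\boldsymbol{y}\}>0$; it is relatively dense if $\sup_{\boldsymbol{x}\in\mathbb{R}^n}\inf_{\boldsymbol{y}\in\mathfrak{B}}\|\boldsymbol{x}-\boldsymbol{y}\|_2<\infty$; it is a Delone set if it is both uniformly discrete and relatively dense. $\mathbb{S}^d$ denotes the unit sphere in $\mathbb{R}^{n}$, $n=d+1$. *)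

theory Defs
  imports "HOL-Analysis.Analysis"
begin

section \<open>Delone sets\<close>

definition relatively_dense :: "'a::euclidean_space set \<Rightarrow> bool" where
  "relatively_dense B \<longleftrightarrow> (SUP x. INF y\<in>B. ereal (dist x y)) < \<infinity>"

definition Delone :: "'a::euclidean_space set \<Rightarrow> bool" where
  "Delone B \<longleftrightarrow> uniform_discrete B \<and> relatively_dense B"

text \<open>
  The library's \<^const>\<open>uniform_discrete\<close> is the condition that the infimum of the distances between
  distinct points is positive. Infima and suprema are taken in \<^typ>\<open>ereal\<close>, where the infimum over
  the empty set is \<open>\<infinity>\<close>: a set with at most one point is uniformly discrete, and the empty set
  is not relatively dense.
\<close>

lemma uniform_discrete_iff_INF:
  fixes B :: "'a::euclidean_space set"
  shows "uniform_discrete B \<longleftrightarrow>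
    0 < (INF (x, y) \<in> {(x, y). x \<in> B \<and> y \<in> B \<and> x \<noteq> y}. ereal (dist x y))" (is "_ \<longleftrightarrow> 0 < ?I")
proof
  assume "uniform_discrete B"
  then obtain e where e: "e > 0" "\<And>x y. x \<in> B \<Longrightarrow> y \<in> B \<Longrightarrow> dist x y < e \<Longrightarrow> x = y"
    unfolding uniform_discrete_def by blast
  have "ereal e \<le> ?I"
  proof (rule INF_greatest, clarify)
    fix x y assume "x \<in> B" "y \<in> B" "x \<noteq> y"
    then have "\<not> dist x y < e"
      using e(2) by blast
    then show "ereal e \<le> ereal (dist x y)"
      by simp
  qed
  moreover have "0 < ereal e"
    using e(1) by simp
  ultimately show "0 < ?I"
    by (rule less_le_trans[rotated])
next
  assume "0 < ?I"
  then obtain e where e: "0 < ereal e" "ereal e < ?I"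
    by (rule ereal_dense2[THEN exE]) auto
  have "x = y" if "x \<in> B" "y \<in> B" "dist x y < e" for x y
  proof (rule ccontr)
    assume "x \<noteq> y"
    then have "?I \<le> ereal (dist x y)"
      using that by (intro INF_lower2[of "(x, y)"]) auto
    then have "ereal e < ereal (dist x y)"
      using e(2) by (rule less_le_trans[rotated])
    with that(3) show False
      by simp
  qed
  with e(1) show "uniform_discrete B"
    unfolding uniform_discrete_def by auto
qed


section \<open>Computable sequences\<close>

text \<open>
  Total recursive functions in Kleene's sense: \<open>recursive n f\<close> says that \<open>f\<close>, restricted to argument
  lists of length \<open>n\<close>, is an \<open>n\<close>-ary total recursive function. The values of \<open>f\<close> on lists of any other
  length carry no meaning. Minimisation is only applied to regular functions, so that all
  functions stay total.
\<close>

inductive recursive :: "nat \<Rightarrow> (nat list \<Rightarrow> nat) \<Rightarrow> bool" where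
  zero: "recursive n (\<lambda>_. 0)"
| succ: "recursive 1 (\<lambda>xs. Suc (xs ! 0))"
| proj: "i < n \<Longrightarrow> recursive n (\<lambda>xs. xs ! i)"
| comp: "recursive (length gs) f \<Longrightarrow> (\<forall>g\<in>set gs. recursive n g) \<Longrightarrow>
    recursive n (\<lambda>xs. f (map (\<lambda>g. g xs) gs))"
| prim_rec: "recursive n f \<Longrightarrow> recursive (Suc (Suc n)) g \<Longrightarrow>
    recursive (Suc n) (\<lambda>xs. rec_nat (f (tl xs)) (\<lambda>i r. g (i # r # tl xs)) (hd xs))"
| minim: "recursive (Suc n) f \<Longrightarrow> (\<forall>xs. length xs = n \<longrightarrow> (\<exists>y. f (y # xs) = 0)) \<Longrightarrow>
    recursive n (\<lambda>xs. LEAST y. f (y # xs) = 0)"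

text \<open>
  Computable sequences of reals in the sense of Pour-El and Richards: the rationals
  \<open>(-1)^s(k,m) a(k,m) / b(k,m)\<close>, with \<open>s\<close>, \<open>a\<close>, \<open>b\<close> recursive, approximate \<open>x k\<close> up to \<open>2^(-m)\<close>.
  One algorithm has to serve all \<open>k\<close>; every single term being a computable real would not suffice.
\<close>

definition computable_real_seq :: "(nat \<Rightarrow> real) \<Rightarrow> bool" where
  "computable_real_seq x \<longleftrightarrow>
    (\<exists>s a b. recursive 2 s \<and> recursive 2 a \<and> recursive 2 b \<and>
      (\<forall>k m. b [k, m] \<noteq> 0 \<and>
        \<bar>(-1) ^ s [k, m] * real (a [k, m]) / real (b [k, m]) - x k\<bar> \<le> 1 / 2 ^ m))"

definition computable_vec_seq :: "(nat \<Rightarrow> real ^ 'n) \<Rightarrow> bool" where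
  "computable_vec_seq u \<longleftrightarrow> (\<forall>i. computable_real_seq (\<lambda>k. u k $ i))"


section \<open>Spiral sets\<close>

text \<open>The term \<open>u 0\<close> is irrelevant: the sequence starts at index 1.\<close>

definition spiral_set :: "(nat \<Rightarrow> real ^ 'n) \<Rightarrow> (real ^ 'n) set" where
  "spiral_set u = {root CARD('n) (real k) *\<^sub>R u k | k. k \<ge> 1}"

end

theory Submission
  imports Defs
begin

text \<open>
  While \<open>root n k\<close> is of order \<open>2^l\<close>, let \<open>u k\<close> run periodically through the radial projections of a
  net of mesh \<open>2^-l\<close> on the surface of the cube \<open>[-1,1]^n\<close>. One period has about \<open>2^(l(n-1))\<close> terms, so
  \<open>root n k\<close> grows by a bounded amount, bounded away from 0, during it. Hence the spiral set is
  relatively dense, and equal directions recur at separated radii. Distinct directions from levels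
  \<open>l\<close> or \<open>l + 1\<close> differ by at least a multiple of \<open>2^-l\<close>, provided that the nets of consecutive levels
  are disjoint, so the points at radius about \<open>2^l\<close> are separated as well. The coordinates of the net
  are given by the digits of \<open>k\<close> in base \<open>2^l\<close>, and projecting to the sphere only takes a square root;
  so the sequence is computable.
\<close>

section \<open>Recursive functions\<close>

text \<open>
  The values of \<open>f\<close> on lists of the wrong length are irrelevant, which makes the notion
  invariant under pointwise equality and so closed under the usual operations.
\<close>

definition rec_fun :: "nat \<Rightarrow> (nat list \<Rightarrow> nat) \<Rightarrow> bool" where
  "rec_fun n f \<longleftrightarrow> (\<exists>g. recursive n g \<and> (\<forall>xs. length xs = n \<longrightarrow> g xs = f xs))"

lemma rec_funI: "recursive n f \<Longrightarrow> rec_fun n f"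
  unfolding rec_fun_def by blast

lemma rec_fun_cong:
  assumes "rec_fun n f" "\<And>xs. length xs = n \<Longrightarrow> f xs = g xs"
  shows "rec_fun n g"
  using assms unfolding rec_fun_def by metis

lemma rec_fun_proj: "i < n \<Longrightarrow> rec_fun n (\<lambda>xs. xs ! i)"
  by (rule rec_funI[OF recursive.proj])

lemma rec_fun_comp1:
  assumes "rec_fun 1 f" "rec_fun n g"
  shows "rec_fun n (\<lambda>xs. f [g xs])"
proof -
  obtain f' g' where "recursive 1 f'" "\<And>xs. length xs = 1 \<Longrightarrow> f' xs = f xs"
    and "recursive n g'" "\<And>xs. length xs = n \<Longrightarrow> g' xs = g xs"
    using assms unfolding rec_fun_def by metis
  then show ?thesis
    using recursive.comp[of "[g']" f' n] unfolding rec_fun_def by auto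
qed

lemma rec_fun_comp2:
  assumes "rec_fun 2 f" "rec_fun n g" "rec_fun n h"
  shows "rec_fun n (\<lambda>xs. f [g xs, h xs])"
proof -
  obtain f' g' h' where "recursive 2 f'" "\<And>xs. length xs = 2 \<Longrightarrow> f' xs = f xs"
    and "recursive n g'" "\<And>xs. length xs = n \<Longrightarrow> g' xs = g xs"
    and "recursive n h'" "\<And>xs. length xs = n \<Longrightarrow> h' xs = h xs"
    using assms unfolding rec_fun_def by metis
  then show ?thesis
    using recursive.comp[of "[g', h']" f' n] unfolding rec_fun_def by (auto simp: numeral_2_eq_2)
qed

lemma rec_fun_prim_rec:
  assumes "rec_fun n f" "rec_fun (Suc (Suc n)) g"
  shows "rec_fun (Suc n) (\<lambda>xs. rec_nat (f (tl xs)) (\<lambda>i r. g (i # r # tl xs)) (hd xs))"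
proof -
  obtain f' g' where f': "recursive n f'" "\<And>xs. length xs = n \<Longrightarrow> f' xs = f xs"
    and g': "recursive (Suc (Suc n)) g'" "\<And>xs. length xs = Suc (Suc n) \<Longrightarrow> g' xs = g xs"
    using assms unfolding rec_fun_def by metis
  show ?thesis
    by (rule rec_fun_cong[OF rec_funI[OF recursive.prim_rec[OF f'(1) g'(1)]]]) (simp add: f' g')
qed

lemma rec_fun_Least:
  assumes "rec_fun (Suc n) f" "\<And>xs. length xs = n \<Longrightarrow> \<exists>y. f (y # xs) = 0"
  shows "rec_fun n (\<lambda>xs. LEAST y. f (y # xs) = 0)"
proof -
  obtain f' where f': "recursive (Suc n) f'" "\<And>xs. length xs = Suc n \<Longrightarrow> f' xs = f xs"
    using assms(1) unfolding rec_fun_def by metis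
  have "recursive n (\<lambda>xs. LEAST y. f' (y # xs) = 0)"
    using f' assms(2) by (intro recursive.minim) auto
  then show ?thesis
    by (rule rec_fun_cong[OF rec_funI]) (simp add: f')
qed

section \<open>Closure of the recursive functions under arithmetic\<close>

lemma rec_fun_Suc:
  assumes "rec_fun n f"
  shows "rec_fun n (\<lambda>xs. Suc (f xs))"
  using rec_fun_comp1[OF rec_funI[OF recursive.succ] assms] by simp

lemma rec_fun_const: "rec_fun n (\<lambda>_. c)"
  by (induction c) (auto intro: rec_funI recursive.zero rec_fun_Suc)

text \<open>The arithmetic operations below recurse on one argument \<open>a\<close> and keep the
  other one \<open>b\<close> as a parameter; this form of the recursion scheme substitutes both at
  once.\<close>

lemma rec_fun_prim_rec2:
  assumes "rec_fun 1 f" "rec_fun 3 g" "rec_fun n a" "rec_fun n b"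
  shows "rec_fun n (\<lambda>xs. rec_nat (f [b xs]) (\<lambda>i r. g [i, r, b xs]) (a xs))"
proof -
  have "rec_fun 2 (\<lambda>xs. rec_nat (f (tl xs)) (\<lambda>i r. g (i # r # tl xs)) (hd xs))"
    using rec_fun_prim_rec[of 1 f g] assms(1,2) by (simp add: numeral_2_eq_2 numeral_3_eq_3)
  from rec_fun_comp2[OF this assms(3,4)] show ?thesis
    by simp
qed

lemma rec_fun_add:
  assumes "rec_fun n f" "rec_fun n g"
  shows "rec_fun n (\<lambda>xs. f xs + g xs)"
proof -
  have eq: "rec_nat y (\<lambda>i r. Suc r) x = x + y" for x y :: nat
    by (induction x) auto
  have "rec_fun 1 (\<lambda>xs. xs ! 0)" "rec_fun 3 (\<lambda>xs. Suc (xs ! 1))"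
    by (auto intro!: rec_fun_proj rec_fun_Suc)
  from rec_fun_prim_rec2[OF this assms] show ?thesis
    by (simp add: eq)
qed

lemma rec_fun_mult:
  assumes "rec_fun n f" "rec_fun n g"
  shows "rec_fun n (\<lambda>xs. f xs * g xs)"
proof -
  have eq: "rec_nat 0 (\<lambda>i r. r + y) x = x * y" for x y :: nat
    by (induction x) auto
  have "rec_fun 3 (\<lambda>xs. xs ! 1 + xs ! 2)"
    by (auto intro!: rec_fun_proj rec_fun_add)
  from rec_fun_prim_rec2[OF rec_fun_const[of 1 0] this assms] show ?thesis
    by (simp add: eq)
qed

lemma rec_fun_power:
  assumes "rec_fun n f" "rec_fun n g"
  shows "rec_fun n (\<lambda>xs. f xs ^ g xs)"
proof -
  have eq: "rec_nat (Suc 0) (\<lambda>i r. r * y) x = y ^ x" for x y :: nat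
    by (induction x) auto
  have "rec_fun 3 (\<lambda>xs. xs ! 1 * xs ! 2)"
    by (auto intro!: rec_fun_proj rec_fun_mult)
  from rec_fun_prim_rec2[OF rec_fun_const[of 1 1] this assms(2,1)] show ?thesis
    by (simp add: eq)
qed

lemma rec_fun_diff:
  assumes "rec_fun n f" "rec_fun n g"
  shows "rec_fun n (\<lambda>xs. f xs - g xs)"
proof -
  have eq0: "rec_nat 0 (\<lambda>i r. i) x = x - 1" for x :: nat
    by (cases x) auto
  have "rec_fun 3 (\<lambda>xs. xs ! 0)"
    by (simp add: rec_fun_proj)
  from rec_fun_prim_rec2[OF rec_fun_const[of 1 0] this]
  have pred: "rec_fun m (\<lambda>xs. h xs - 1)" if "rec_fun m h" for m h
    using that by (simp add: eq0[simplified])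
  have eq: "rec_nat y (\<lambda>i r. r - 1) x = y - x" for x y :: nat
    by (induction x) auto
  have "rec_fun 1 (\<lambda>xs. xs ! 0)" "rec_fun 3 (\<lambda>xs. xs ! 1 - 1)"
    by (auto intro!: rec_fun_proj pred simp del: One_nat_def)
  \<comment> \<open>The recursion runs over the subtrahend, so the two arguments change
    places.\<close>
  from rec_fun_prim_rec2[OF this assms(2,1)] show ?thesis
    by (simp add: eq[simplified])
qed

lemma rec_fun_if_less:
  assumes "rec_fun n a" "rec_fun n b" "rec_fun n f" "rec_fun n g"
  shows "rec_fun n (\<lambda>xs. if a xs < b xs then f xs else g xs)"
proof -
  \<comment> \<open>Subtraction is truncated: \<open>1 - (b xs - a xs)\<close> is 0 if
    \<open>a xs < b xs\<close> and 1 otherwise, so the branches carry complementary weights.\<close>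
  have "rec_fun n (\<lambda>xs. (1 - (1 - (b xs - a xs))) * f xs + (1 - (b xs - a xs)) * g xs)"
    using assms by (intro rec_fun_add rec_fun_mult rec_fun_diff rec_fun_const)
  then show ?thesis
    by (rule rec_fun_cong) auto
qed

lemma rec_fun_if_eq:
  assumes "rec_fun n a" "rec_fun n b" "rec_fun n f" "rec_fun n g"
  shows "rec_fun n (\<lambda>xs. if a xs = b xs then f xs else g xs)"
proof -
  have "rec_fun n (\<lambda>xs. if a xs < b xs then g xs else if b xs < a xs then g xs else f xs)"
    using assms by (intro rec_fun_if_less)
  then show ?thesis
    by (rule rec_fun_cong) auto
qed

lemma rec_fun_sum:
  fixes m :: nat
  assumes "\<And>i. i < m \<Longrightarrow> rec_fun n (f i)"
  shows "rec_fun n (\<lambda>xs. \<Sum>i<m. f i xs)"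
  using assms by (induction m) (auto intro: rec_fun_const rec_fun_add)

text \<open>The quotient of \<open>x\<close> by \<open>z\<close> is the least \<open>y\<close> with
  \<open>x < Suc y * z\<close>, found by minimisation. For \<open>z = 0\<close> the search is made
  to stop at once; its result 0 is the value of \<open>x div 0\<close>.\<close>

lemma rec_fun_div:
  assumes "rec_fun n f" "rec_fun n g"
  shows "rec_fun n (\<lambda>xs. f xs div g xs)"
proof -
  define F :: "nat list \<Rightarrow> nat"
    where "F = (\<lambda>xs. if xs ! 2 = 0 then 0 else if xs ! 1 < Suc (xs ! 0) * xs ! 2 then 0 else 1)"
  have "rec_fun 3 F"
    unfolding F_def
    by (intro rec_fun_if_less rec_fun_if_eq rec_fun_mult rec_fun_Suc rec_fun_const rec_fun_proj) auto
  have F: "F (y # xs) = 0 \<longleftrightarrow> xs ! 1 = 0 \<or> xs ! 0 < Suc y * xs ! 1" if "length xs = 2" for xs y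
    by (auto simp: F_def numeral_2_eq_2)
  have "rec_fun 2 (\<lambda>xs. LEAST y. F (y # xs) = 0)"
  proof (rule rec_fun_Least)
    show "\<exists>y. F (y # xs) = 0" if "length xs = 2" for xs
      using dividend_less_div_times[of "xs ! 1" "xs ! 0"]
      by (intro exI[of _ "xs ! 0 div xs ! 1"]) (auto simp: F that)
  qed (use \<open>rec_fun 3 F\<close> in \<open>simp add: numeral_2_eq_2 numeral_3_eq_3\<close>)
  moreover have "(LEAST y. F (y # xs) = 0) = xs ! 0 div xs ! 1" if "length xs = 2" for xs
  proof (cases "xs ! 1 = 0")
    case False
    show ?thesis
    proof (rule Least_equality)
      show "F ((xs ! 0 div xs ! 1) # xs) = 0"
        using dividend_less_div_times[of "xs ! 1" "xs ! 0"] False by (auto simp: F that)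
      show "xs ! 0 div xs ! 1 \<le> y" if "F (y # xs) = 0" for y
        using that False F[OF \<open>length xs = 2\<close>, of y]
        by (metis less_Suc_eq_le less_mult_imp_div_less)
    qed
  qed (use that in \<open>auto simp: F intro: Least_equality\<close>)
  ultimately have "rec_fun 2 (\<lambda>xs. xs ! 0 div xs ! 1)"
    by (rule rec_fun_cong)
  from rec_fun_comp2[OF this assms] show ?thesis
    by simp
qed

lemma rec_fun_mod:
  assumes "rec_fun n f" "rec_fun n g"
  shows "rec_fun n (\<lambda>xs. f xs mod g xs)"
  unfolding modulo_nat_def using assms by (intro rec_fun_diff rec_fun_mult rec_fun_div)

lemma rec_fun_1_to_2:
  assumes "rec_fun 1 (\<lambda>xs. f (xs ! 0))"
  shows "rec_fun 2 (\<lambda>xs. f (xs ! 0))"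
  using rec_fun_comp1[OF assms, of 2 "\<lambda>xs. xs ! 0"] by (simp add: rec_fun_proj)

section \<open>Approximation of quotients by square roots\<close>

text \<open>With \<open>m = xs ! 1\<close>, the floor is the least \<open>y\<close> with
  \<open>2 ^ m * a < Suc y * sqrt q\<close>. Squaring turns this into a comparison of natural
  numbers, so minimisation finds it.\<close>

lemma rec_fun_div_sqrt:
  assumes a: "rec_fun 1 (\<lambda>xs. a (xs ! 0))" and q: "rec_fun 1 (\<lambda>xs. q (xs ! 0))"
    and pos: "\<And>k. q k > 0"
  shows "rec_fun 2 (\<lambda>xs. nat \<lfloor>2 ^ (xs ! 1) * real (a (xs ! 0)) / sqrt (real (q (xs ! 0)))\<rfloor>)"
proof -
  define F :: "nat list \<Rightarrow> nat"
    where "F = (\<lambda>xs. if (2 ^ xs ! 2 * a (xs ! 1)) ^ 2 < Suc (xs ! 0) ^ 2 * q (xs ! 1) then 0 else 1)"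
  have a': "rec_fun 3 (\<lambda>xs. a (xs ! 1))" and q': "rec_fun 3 (\<lambda>xs. q (xs ! 1))"
    using rec_fun_comp1[OF a, of 3 "\<lambda>xs. xs ! 1"] rec_fun_comp1[OF q, of 3 "\<lambda>xs. xs ! 1"]
    by (auto simp: rec_fun_proj)
  have "rec_fun 3 F"
    unfolding F_def
    by (intro rec_fun_if_less rec_fun_mult rec_fun_power rec_fun_Suc a' q' rec_fun_const
        rec_fun_proj) auto
  define x where "x = (\<lambda>xs. 2 ^ (xs ! 1) * real (a (xs ! 0)) / sqrt (real (q (xs ! 0))))"
  have F: "F (y # xs) = 0 \<longleftrightarrow> x xs < real (Suc y)" if "length xs = 2" for xs y
  proof -
    define A Q where "A = a (xs ! 0)" and "Q = q (xs ! 0)"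
    have Q: "Q > 0"
      using pos by (simp add: Q_def)
    have "F (y # xs) = 0 \<longleftrightarrow> (2 ^ xs ! 1 * A) ^ 2 < Suc y ^ 2 * Q"
      by (auto simp: F_def A_def Q_def numeral_2_eq_2)
    also have "\<dots> \<longleftrightarrow> (2 ^ xs ! 1 * real A) ^ 2 < real (Suc y) ^ 2 * real Q"
      by (metis (no_types, lifting) of_nat_less_iff of_nat_mult of_nat_numeral of_nat_power)
    also have "\<dots> \<longleftrightarrow> (2 ^ xs ! 1 * real A) ^ 2 < (real (Suc y) * sqrt (real Q)) ^ 2"
      by (simp add: power_mult_distrib)
    also have "\<dots> \<longleftrightarrow> 2 ^ xs ! 1 * real A < real (Suc y) * sqrt (real Q)"
      by (simp only: not_le[symmetric]) (subst power_mono_iff, auto)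
    also have "\<dots> \<longleftrightarrow> x xs < real (Suc y)"
      using Q by (simp add: x_def A_def Q_def pos_divide_less_eq)
    finally show ?thesis .
  qed
  have "rec_fun 2 (\<lambda>xs. LEAST y. F (y # xs) = 0)"
  proof (rule rec_fun_Least)
    show "\<exists>y. F (y # xs) = 0" if "length xs = 2" for xs
      using reals_Archimedean2[of "x xs"] unfolding F[OF that] by (meson less_trans lessI of_nat_less_iff)
  qed (use \<open>rec_fun 3 F\<close> in \<open>simp add: numeral_2_eq_2 numeral_3_eq_3\<close>)
  moreover have "(LEAST y. F (y # xs) = 0) = nat \<lfloor>x xs\<rfloor>" if "length xs = 2" for xs
  proof -
    have "x xs \<ge> 0"
      by (simp add: x_def)
    show ?thesis
      unfolding F[OF that]
    proof (rule Least_equality)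
      show "x xs < real (Suc (nat \<lfloor>x xs\<rfloor>))"
        using \<open>x xs \<ge> 0\<close> by linarith
      show "nat \<lfloor>x xs\<rfloor> \<le> y" if "x xs < real (Suc y)" for y
        using \<open>x xs \<ge> 0\<close> that by linarith
    qed
  qed
  ultimately show ?thesis
    unfolding x_def by (rule rec_fun_cong)
qed

text \<open>Sign and absolute value are computed separately. Rounding \<open>2 ^ m\<close> times the
  absolute value down gives a numerator over \<open>2 ^ m\<close> with error at most
  \<open>1 / 2 ^ m\<close>.\<close>

lemma computable_real_seq_div_sqrt:
  assumes a: "rec_fun 1 (\<lambda>xs. a (xs ! 0))" and b: "rec_fun 1 (\<lambda>xs. b (xs ! 0))"
    and q: "rec_fun 1 (\<lambda>xs. q (xs ! 0))" and pos: "\<And>k. q k > 0"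
  shows "computable_real_seq (\<lambda>k. (real (a k) - real (b k)) / sqrt (real (q k)))"
proof -
  define s where "s = (\<lambda>k. if a k < b k then 1 else 0 :: nat)"
  \<comment> \<open>One of the two truncated differences vanishes, so \<open>d k\<close> is the
    absolute value of the difference.\<close>
  define d where "d = (\<lambda>k. (a k - b k) + (b k - a k))"
  have s: "rec_fun 2 (\<lambda>xs. s (xs ! 0))"
    unfolding s_def using a b by (intro rec_fun_if_less rec_fun_const rec_fun_1_to_2)
  have d: "rec_fun 1 (\<lambda>xs. d (xs ! 0))"
    unfolding d_def using a b by (intro rec_fun_add rec_fun_diff)
  have x: "(real (a k) - real (b k)) / sqrt (real (q k)) = (- 1) ^ s k * (real (d k) / sqrt (real (q k)))"
    for k by (simp add: s_def d_def)
  define c where "c = (\<lambda>xs. nat \<lfloor>2 ^ (xs ! 1) * real (d (xs ! 0)) / sqrt (real (q (xs ! 0)))\<rfloor>)"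
  have "rec_fun 2 c"
    unfolding c_def by (rule rec_fun_div_sqrt[OF d q pos])
  have "rec_fun 2 (\<lambda>xs. 2 ^ (xs ! 1))"
    by (intro rec_fun_power rec_fun_const rec_fun_proj) auto
  obtain s' c' b' where rec: "recursive 2 s'" "recursive 2 c'" "recursive 2 b'"
    and s': "\<And>k m. s' [k, m] = s k" and c': "\<And>k m. c' [k, m] = c [k, m]"
    and b': "\<And>k m. b' [k, m] = 2 ^ m"
    using s \<open>rec_fun 2 c\<close> \<open>rec_fun 2 (\<lambda>xs. 2 ^ (xs ! 1))\<close> unfolding rec_fun_def by force
  have "\<bar>(- 1) ^ s' [k, m] * real (c' [k, m]) / real (b' [k, m])
      - (real (a k) - real (b k)) / sqrt (real (q k))\<bar> \<le> 1 / 2 ^ m" for k m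
  proof -
    define t where "t = real (d k) / sqrt (real (q k))"
    have "t \<ge> 0"
      by (simp add: t_def)
    then have "2 ^ m * t \<ge> 0"
      by simp
    moreover have "c' [k, m] = nat \<lfloor>2 ^ m * t\<rfloor>"
      by (simp add: c' c_def t_def)
    ultimately have "\<bar>real (c' [k, m]) - 2 ^ m * t\<bar> \<le> 1"
      by linarith
    then have "\<bar>(real (c' [k, m]) - 2 ^ m * t) / 2 ^ m\<bar> \<le> 1 / 2 ^ m"
      by (simp add: divide_right_mono)
    also have "(real (c' [k, m]) - 2 ^ m * t) / 2 ^ m = real (c' [k, m]) / 2 ^ m - t"
      by (simp add: field_simps)
    finally have "\<bar>(- 1) ^ s k * (real (c' [k, m]) / 2 ^ m - t)\<bar> \<le> 1 / 2 ^ m"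
      by (simp add: abs_mult power_abs)
    then show ?thesis
      unfolding x s' b' by (simp add: t_def right_diff_distrib)
  qed
  then show ?thesis
    unfolding computable_real_seq_def using rec by (metis b' power_not_zero zero_neq_numeral)
qed

section \<open>Nested nets on the surface of the cube\<close>

text \<open>For \<open>n > 0\<close> this is the integer part of the logarithm of
  \<open>Suc (k div (2 * n))\<close> to base \<open>2 ^ n\<close>; the \<open>Suc\<close> keeps the
  argument positive. Being a least number, it can be computed by minimisation.\<close>

definition level :: "nat \<Rightarrow> nat \<Rightarrow> nat" where
  "level n k = (LEAST l. Suc (k div (2 * n)) < 2 ^ (n * Suc l))"

text \<open>A least number exists because \<open>l = ?h\<close> satisfies the inequality, by
  \<open>?h < 2 ^ ?h\<close>.\<close>

lemma less_two_power_level: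
  assumes "n > 0"
  shows "Suc (k div (2 * n)) < 2 ^ (n * Suc (level n k))"
proof -
  let ?h = "Suc (k div (2 * n))"
  have "?h < 2 ^ ?h"
    by (rule less_exp)
  also have "\<dots> \<le> (2::nat) ^ (n * Suc ?h)"
  proof (rule power_increasing)
    have "?h \<le> 1 * Suc ?h"
      by simp
    also have "\<dots> \<le> n * Suc ?h"
      using assms by (intro mult_right_mono) auto
    finally show "?h \<le> n * Suc ?h" .
  qed simp
  finally show ?thesis
    unfolding level_def by (rule LeastI)
qed

lemma two_power_level_le: "2 ^ (n * level n k) \<le> Suc (k div (2 * n))"
proof (cases "level n k")
  case (Suc l)
  then have "l < level n k"
    by simp
  then show ?thesis
    using not_less_Least[of l "\<lambda>l. Suc (k div (2 * n)) < 2 ^ (n * Suc l)"] Suc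
    unfolding level_def by simp
qed simp

lemma level_eqI:
  assumes "n > 0" "2 ^ (n * l) \<le> Suc (k div (2 * n))" "Suc (k div (2 * n)) < 2 ^ (n * Suc l)"
  shows "level n k = l"
  unfolding level_def
proof (rule Least_equality)
  fix y assume "Suc (k div (2 * n)) < 2 ^ (n * Suc y)"
  with assms(2) have "(2::nat) ^ (n * l) < 2 ^ (n * Suc y)"
    by (rule le_less_trans)
  then have "n * l < n * Suc y"
    using power_less_imp_less_exp one_less_numeral_iff semiring_norm(76) by blast
  then show "l \<le> y"
    by (simp add: less_Suc_eq_le del: mult_Suc_right)
qed (rule assms(3))

lemma level_mono:
  assumes "n > 0" "k \<le> k'"
  shows "level n k \<le> level n k'"
proof -
  have "Suc (k div (2 * n)) \<le> Suc (k' div (2 * n))"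
    using assms by (simp add: div_le_mono)
  also have "\<dots> < 2 ^ (n * Suc (level n k'))"
    by (rule less_two_power_level[OF assms(1)])
  finally show ?thesis
    unfolding level_def[of n k] by (rule Least_le)
qed

text \<open>
  Write \<open>h = k div 2n + 1\<close> and \<open>l = level n k\<close>. The residue of \<open>k\<close> modulo \<open>2n\<close> selects a face of the
  cube \<open>[-1,1]^n\<close>, the \<open>n - 1\<close> lowest digits \<open>a\<close> of \<open>h\<close> in base \<open>2^l\<close> select a point with coordinates
  \<open>-1 + 2 (a + 1/3) / 2^l\<close> on it, and the remaining part of \<open>h\<close> counts how often the resulting net
  has been traversed. The offset \<open>1/3\<close> makes the nets of
  consecutive levels disjoint.
\<close>

definition digit :: "nat \<Rightarrow> nat \<Rightarrow> nat \<Rightarrow> nat" where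
  "digit n k j = Suc (k div (2 * n)) div (2 ^ level n k) ^ j mod 2 ^ level n k"

definition cube_num :: "nat \<Rightarrow> nat \<Rightarrow> nat \<Rightarrow> nat" where
  "cube_num n k c = (let f = k mod (2 * n) in
     if c = f div 2 then if f mod 2 = 0 then 0 else 3 * 2 ^ level n k
     else 3 * digit n k (if c < f div 2 then c else c - 1) + 1)"

definition cube_coord :: "nat \<Rightarrow> nat \<Rightarrow> nat \<Rightarrow> real" where
  "cube_coord n k c = 2 * real (cube_num n k c) / (3 * 2 ^ level n k) - 1"

lemma digit_less: "digit n k j < 2 ^ level n k"
  by (simp add: digit_def)

text \<open>The summand 1 in \<open>3 * digit + 1\<close> keeps these coordinates strictly inside
  the interval from -1 to 1, which makes the face recognisable from the point.\<close>

lemma cube_num_off_face: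
  assumes "c \<noteq> k mod (2 * n) div 2"
  shows "0 < cube_num n k c" "cube_num n k c < 3 * 2 ^ level n k"
  using assms digit_less[of n k "if c < k mod (2 * n) div 2 then c else c - 1"]
  by (auto simp: cube_num_def Let_def simp del: One_nat_def)

lemma cube_num_le: "cube_num n k c \<le> 3 * 2 ^ level n k"
proof (cases "c = k mod (2 * n) div 2")
  case False
  then show ?thesis
    using cube_num_off_face(2) by (simp add: less_imp_le)
qed (simp add: cube_num_def Let_def)

lemma abs_cube_coord_le: "\<bar>cube_coord n k c\<bar> \<le> 1"
proof -
  have "real (cube_num n k c) \<le> 3 * 2 ^ level n k"
    using cube_num_le[of n k c] by (metis of_nat_le_iff of_nat_mult of_nat_numeral of_nat_power)
  then show ?thesis
    by (simp add: cube_coord_def abs_le_iff field_simps)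
qed

lemma face_less: "n > 0 \<Longrightarrow> k mod (2 * n) div 2 < (n::nat)"
  using mod_less_divisor[of "2 * n" k] by linarith

lemma abs_cube_coord_face: "\<bar>cube_coord n k (k mod (2 * n) div 2)\<bar> = 1"
  by (simp add: cube_coord_def cube_num_def Let_def)

section \<open>Coincidence and separation of net points\<close>

lemma cube_coord_eq_iff:
  "cube_coord n k c = cube_coord n k' c' \<longleftrightarrow>
    cube_num n k c * 2 ^ level n k' = cube_num n k' c' * 2 ^ level n k"
proof -
  have "cube_coord n k c = cube_coord n k' c' \<longleftrightarrow>
      real (cube_num n k c * 2 ^ level n k') = real (cube_num n k' c' * 2 ^ level n k)"
    by (simp add: cube_coord_def field_simps)
  then show ?thesis
    by (simp only: of_nat_eq_iff)
qed

text \<open>Only the coordinate belonging to the face takes a value -1 or 1, and its sign gives the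
  parity of the residue.\<close>

lemma cube_coord_eq_face:
  assumes "n > 0" and eq: "\<And>c. c < n \<Longrightarrow> cube_coord n k c = cube_coord n k' c"
  shows "k mod (2 * n) = k' mod (2 * n)"
proof -
  let ?f = "k mod (2 * n)" and ?f' = "k' mod (2 * n)"
  have 1: "cube_num n k (?f div 2) * 2 ^ level n k' = cube_num n k' (?f div 2) * 2 ^ level n k"
    using eq[of "?f div 2"] face_less[OF assms(1)] by (simp add: cube_coord_eq_iff)
  have face: "?f div 2 = ?f' div 2"
  proof (rule ccontr)
    assume "?f div 2 \<noteq> ?f' div 2"
    then have "0 < cube_num n k' (?f div 2)" "cube_num n k' (?f div 2) < 3 * 2 ^ level n k'"
      using cube_num_off_face[of "?f div 2" k' n] by auto
    moreover have "cube_num n k (?f div 2) = 0 \<or> cube_num n k (?f div 2) = 3 * 2 ^ level n k"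
      by (simp add: cube_num_def Let_def)
    then have "cube_num n k' (?f div 2) = 0 \<or> cube_num n k' (?f div 2) = 3 * 2 ^ level n k'"
      using 1 by auto
    ultimately show False
      by auto
  qed
  have "?f mod 2 = ?f' mod 2"
    using 1 unfolding face
    by (auto simp: cube_num_def Let_def face split: if_splits)
  with face show ?thesis
    by (metis div_mult_mod_eq)
qed

text \<open>Over the common denominator of the finer level \<open>level n k'\<close> both numerators
  are integers, so distinct ones differ by at least 1.\<close>

lemma abs_cube_coord_diff_ge:
  assumes "cube_coord n k c \<noteq> cube_coord n k' c" "level n k \<le> level n k'"
  shows "\<bar>cube_coord n k c - cube_coord n k' c\<bar> \<ge> 2 / (3 * 2 ^ level n k')"
proof -
  define a b where "a = cube_num n k c * 2 ^ (level n k' - level n k)" and "b = cube_num n k' c"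
  have pow: "(2::real) ^ level n k' = 2 ^ (level n k' - level n k) * 2 ^ level n k"
    using assms(2) by (simp flip: power_add)
  have diff: "cube_coord n k c - cube_coord n k' c = (real a - real b) * (2 / (3 * 2 ^ level n k'))"
    unfolding cube_coord_def a_def b_def pow by (simp add: field_simps)
  with assms(1) have "a \<noteq> b"
    by auto
  then have "1 \<le> \<bar>real a - real b\<bar>"
    by linarith
  from mult_right_mono[OF this, of "2 / (3 * 2 ^ level n k')"] show ?thesis
    unfolding diff abs_mult by simp
qed

lemma mod_power_eqI:
  fixes x y b :: nat
  assumes "\<And>j. j < m \<Longrightarrow> x div b ^ j mod b = y div b ^ j mod b"
  shows "x mod b ^ m = y mod b ^ m"
  using assms
proof (induction m)
  case (Suc m)
  then show ?case
    by (simp add: mod_mult2_eq power_Suc2 del: power_Suc)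
qed simp

text \<open>Equal points share the face and the \<open>n - 1\<close> low digits, so \<open>h\<close>
  and \<open>h'\<close> are congruent modulo \<open>b ^ (n - 1)\<close>, the number of net points on
  one face.\<close>

lemma cube_coord_eq_same_level:
  assumes n: "n > 0" and "k < k'" and l: "level n k = level n k'"
    and eq: "\<And>c. c < n \<Longrightarrow> cube_coord n k c = cube_coord n k' c"
  shows "2 ^ (level n k' * (n - 1)) \<le> k' - k"
proof -
  define h h' where "h = Suc (k div (2 * n))" and "h' = Suc (k' div (2 * n))"
  define b where "b = (2::nat) ^ level n k'"
  have f: "k mod (2 * n) = k' mod (2 * n)"
    using cube_coord_eq_face[OF n eq] .
  have num: "cube_num n k c = cube_num n k' c" if "c < n" for c
    using eq[OF that] by (simp add: cube_coord_eq_iff l)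
  have "h div b ^ j mod b = h' div b ^ j mod b" if "j < n - 1" for j
  proof -
    let ?c = "if j < k mod (2 * n) div 2 then j else Suc j"
    have "?c < n"
      using that by auto
    from num[OF this] have "digit n k j = digit n k' j"
      by (auto simp: cube_num_def Let_def f[symmetric] split: if_splits)
    then show ?thesis
      by (simp add: digit_def l h_def h'_def b_def)
  qed
  then have "h mod b ^ (n - 1) = h' mod b ^ (n - 1)"
    by (rule mod_power_eqI)
  moreover have "h \<le> h'"
    using \<open>k < k'\<close> by (simp add: h_def h'_def div_le_mono)
  ultimately have "b ^ (n - 1) dvd h' - h"
    using mod_eq_dvd_iff_nat by metis
  have k: "k = 2 * n * (h - 1) + k mod (2 * n)"
    by (simp add: h_def)
  have k': "k' = 2 * n * (h' - 1) + k mod (2 * n)"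
    unfolding f by (simp add: h'_def)
  \<comment> \<open>The residues modulo \<open>2 * n\<close> agree, so distinct indices can only
    come from distinct \<open>h\<close>.\<close>
  have "h \<noteq> h'"
    using k k' \<open>k < k'\<close> by (metis less_irrefl)
  with \<open>h \<le> h'\<close> \<open>b ^ (n - 1) dvd h' - h\<close> have "b ^ (n - 1) \<le> h' - h"
    by (simp add: dvd_imp_le)
  also have "\<dots> \<le> 2 * n * (h' - h)"
    using n by simp
  also have "\<dots> = 2 * n * (h' - 1) - 2 * n * (h - 1)"
    by (simp add: h_def h'_def diff_mult_distrib2)
  also have "\<dots> \<le> k' - k"
    using k k' by linarith
  finally show ?thesis
    by (simp add: b_def power_mult)
qed

text \<open>Over a common denominator a coordinate off the face has a numerator
  \<open>2 * (3 * a + 1)\<close> on the coarser level and \<open>3 * a' + 1\<close> on the finer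
  one; these are 2 and 1 modulo 3.\<close>

lemma cube_coord_neq_Suc_level:
  assumes n: "n \<ge> 2" and l: "level n k' = Suc (level n k)"
  shows "\<exists>c<n. cube_coord n k c \<noteq> cube_coord n k' c"
proof (rule ccontr)
  assume "\<not> ?thesis"
  then have eq: "cube_coord n k c = cube_coord n k' c" if "c < n" for c
    using that by blast
  have f: "k mod (2 * n) = k' mod (2 * n)"
    using n by (intro cube_coord_eq_face[OF _ eq]) auto
  \<comment> \<open>A coordinate off the face; it exists because \<open>n \<ge> 2\<close>.\<close>
  define c where "c = (if k mod (2 * n) div 2 = 0 then 1 else 0 :: nat)"
  have c: "c < n" "c \<noteq> k mod (2 * n) div 2"
    using n by (auto simp: c_def)
  have "2 * cube_num n k c = cube_num n k' c"
    using eq[OF c(1)] by (simp add: cube_coord_eq_iff l)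
  then have "2 * cube_num n k c mod 3 = cube_num n k' c mod 3"
    by simp
  moreover have "cube_num n k c mod 3 = 1" "cube_num n k' c mod 3 = 1"
    using c(2) f by (auto simp: cube_num_def Let_def)
  ultimately show False
    by presburger
qed

text \<open>With \<open>m = level n k' - 1\<close>, a whole level lies in between:
  \<open>h < 2 ^ (n * m)\<close>, whereas \<open>h'\<close> is at least twice this power. The factor
  \<open>2 ^ (n - 1)\<close> pays for passing from \<open>m\<close> to
  \<open>level n k'\<close>.\<close>

lemma two_levels_apart:
  assumes n: "n > 0" and l: "level n k + 2 \<le> level n k'"
  shows "2 ^ (level n k' * (n - 1)) \<le> 2 ^ (n - 1) * (k' - k)"
proof -
  define h h' where "h = Suc (k div (2 * n))" and "h' = Suc (k' div (2 * n))"
  define m where "m = level n k' - 1"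
  have m: "level n k' = Suc m" "Suc (level n k) \<le> m"
    using l by (auto simp: m_def)
  have "h < 2 ^ (n * Suc (level n k))"
    unfolding h_def by (rule less_two_power_level[OF n])
  also have "\<dots> \<le> (2::nat) ^ (n * m)"
    using m(2) by (intro power_increasing mult_left_mono) auto
  finally have h: "h < 2 ^ (n * m)" .
  have "2 * (2::nat) ^ (n * m) \<le> 2 ^ n * 2 ^ (n * m)"
    using n self_le_power[of "2::nat" n] by (intro mult_right_mono) auto
  also have "\<dots> = 2 ^ (n * level n k')"
    by (simp add: m(1) power_add)
  also have "\<dots> \<le> h'"
    unfolding h'_def by (rule two_power_level_le)
  finally have "2 ^ (n * m) \<le> h' - 1 - h"
    using h by linarith
  also have "\<dots> \<le> 2 * n * (h' - 1 - h)"
    using n by simp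
  also have "\<dots> \<le> k' - k"
  proof -
    have "k = 2 * n * (h - 1) + k mod (2 * n)" "k' = 2 * n * (h' - 1) + k' mod (2 * n)"
      by (simp_all add: h_def h'_def)
    moreover have "k mod (2 * n) < 2 * n"
      using n by simp
    moreover have "2 * n * h = 2 * n * (h - 1) + 2 * n"
      by (simp add: h_def)
    ultimately have "k \<le> 2 * n * h" "2 * n * (h' - 1) \<le> k'"
      by linarith+
    then show ?thesis
      unfolding diff_mult_distrib2 by linarith
  qed
  finally have *: "2 ^ (n * m) \<le> k' - k" .
  have "(2::nat) ^ (level n k' * (n - 1)) = 2 ^ (n - 1) * 2 ^ (m * (n - 1))"
    by (simp add: m(1) power_add)
  also have "\<dots> \<le> 2 ^ (n - 1) * 2 ^ (n * m)"
    by (intro mult_left_mono power_increasing) (auto simp: mult.commute)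
  also have "\<dots> \<le> 2 ^ (n - 1) * (k' - k)"
    by (rule mult_left_mono[OF *]) simp
  finally show ?thesis .
qed

text \<open>The first alternative will separate the radii, the second the directions. Repeated
  points of one level and indices at least two levels apart fall under the first.\<close>

lemma cube_coord_dichotomy:
  assumes n: "n \<ge> 2" and "k < k'"
  shows "2 ^ (level n k' * (n - 1)) \<le> 2 ^ (n - 1) * (k' - k) \<or>
    level n k \<le> level n k' \<and> level n k' \<le> Suc (level n k) \<and>
      (\<exists>c<n. cube_coord n k c \<noteq> cube_coord n k' c)"
proof -
  have "n > 0"
    using n by simp
  have le: "level n k \<le> level n k'"
    using \<open>n > 0\<close> \<open>k < k'\<close> by (intro level_mono) auto
  consider "level n k' = level n k" | "level n k' = Suc (level n k)" | "level n k + 2 \<le> level n k'"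
    using le by linarith
  then show ?thesis
  proof cases
    case 1
    show ?thesis
    proof (cases "\<exists>c<n. cube_coord n k c \<noteq> cube_coord n k' c")
      case False
      then have "2 ^ (level n k' * (n - 1)) \<le> k' - k"
        using 1 \<open>n > 0\<close> \<open>k < k'\<close> by (intro cube_coord_eq_same_level) auto
      also have "\<dots> \<le> 2 ^ (n - 1) * (k' - k)"
        by simp
      finally show ?thesis
        by simp
    qed (use 1 in auto)
  next
    case 2
    then show ?thesis
      using cube_coord_neq_Suc_level[OF n 2] by simp
  next
    case 3
    then show ?thesis
      using two_levels_apart[OF \<open>n > 0\<close> 3] by simp
  qed
qed

section \<open>Density of the nets\<close>

text \<open>The induction hypothesis is used with the quotient \<open>q * b + a m\<close>, which
  places the top digit \<open>a m\<close> below \<open>q\<close>.\<close>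

lemma exists_digits:
  fixes a :: "nat \<Rightarrow> nat"
  assumes "\<And>j. j < m \<Longrightarrow> a j < b"
  shows "\<exists>h. h div b ^ m = q \<and> (\<forall>j<m. h div b ^ j mod b = a j)"
  using assms
proof (induction m arbitrary: q)
  case (Suc m)
  then obtain h where h: "h div b ^ m = q * b + a m" "\<forall>j<m. h div b ^ j mod b = a j"
    by (metis less_SucI)
  have "h div b ^ Suc m = q"
    using h(1) Suc.prems[of m] by (simp add: power_Suc2 div_mult2_eq del: power_Suc)
  moreover have "h div b ^ m mod b = a m"
    using h(1) Suc.prems[of m] by simp
  ultimately show ?case
    using h(2) by (metis less_Suc_eq)
qed simp

lemma exists_near_cell:
  fixes y :: real
  assumes "\<bar>y\<bar> \<le> 1"
  shows "\<exists>a<2 ^ l. \<bar>2 * real (3 * a + 1) / (3 * 2 ^ l) - 1 - y\<bar> \<le> 2 / 2 ^ l"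
proof -
  \<comment> \<open>The position of \<open>y\<close> in units of the cell length. The cell index is
    its floor, except for \<open>t = 2 ^ l\<close>, where the last cell is taken.\<close>
  define t where "t = (y + 1) / 2 * 2 ^ l"
  have t: "0 \<le> t" "t \<le> 2 ^ l"
    using assms by (auto simp: t_def abs_le_iff mult_left_le_one_le)
  obtain a :: nat where a: "a < 2 ^ l" "\<bar>real a + 1 / 3 - t\<bar> \<le> 1"
  proof (cases "t < 2 ^ l")
    case True
    have "real (nat \<lfloor>t\<rfloor>) < 2 ^ l"
      using True t by linarith
    then have "nat \<lfloor>t\<rfloor> < 2 ^ l"
      by (metis of_nat_less_iff of_nat_numeral of_nat_power)
    moreover have "\<bar>real (nat \<lfloor>t\<rfloor>) + 1 / 3 - t\<bar> \<le> 1"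
      using t by linarith
    ultimately show ?thesis
      by (rule that)
  next
    case False
    with t have "t = 2 ^ l"
      by linarith
    then show ?thesis
      by (intro that[of "2 ^ l - 1"]) (auto simp: of_nat_diff)
  qed
  have "2 * real (3 * a + 1) / (3 * 2 ^ l) - 1 - y = (real a + 1 / 3 - t) * (2 / 2 ^ l)"
    by (simp add: t_def field_simps)
  also have "\<bar>\<dots>\<bar> \<le> 1 * (2 / 2 ^ l)"
    unfolding abs_mult by (rule mult_mono) (use a in auto)
  finally show ?thesis
    using a(1) by auto
qed

text \<open>In \<open>k0\<close> only the face and the \<open>n - 1\<close> low digits of
  \<open>h0\<close> are exchanged for those of the cells containing \<open>y\<close>. The higher
  part stays, so the level is kept and the index moves by at most one period.\<close>

lemma cube_coord_dense:
  fixes y :: "nat \<Rightarrow> real"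
  assumes n: "n > 0" and y: "\<And>c. c < n \<Longrightarrow> \<bar>y c\<bar> \<le> 1" and c0: "c0 < n" "\<bar>y c0\<bar> = 1"
  shows "\<exists>k. level n k = level n k0 \<and>
    \<bar>real k - real k0\<bar> \<le> 2 * real n * 2 ^ (level n k0 * (n - 1)) \<and>
    (\<forall>c<n. \<bar>cube_coord n k c - y c\<bar> \<le> 2 / 2 ^ level n k0)"
proof -
  define l where "l = level n k0"
  define h0 where "h0 = Suc (k0 div (2 * n))"
  define b where "b = (2::nat) ^ l"
  define M where "M = b ^ (n - 1)"
  have "M > 0" "b > 0"
    by (auto simp: M_def b_def)
  \<comment> \<open>An even residue encodes the face with coordinate -1, an odd one the face with
    coordinate 1.\<close>
  define f where "f = 2 * c0 + (if y c0 = 1 then 1 else 0)"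
  have f: "f < 2 * n" "f div 2 = c0"
    using c0 by (auto simp: f_def)
  have "\<forall>c. \<exists>a. c < n \<longrightarrow> a < 2 ^ l \<and> \<bar>2 * real (3 * a + 1) / (3 * 2 ^ l) - 1 - y c\<bar> \<le> 2 / 2 ^ l"
    using exists_near_cell[OF y] by blast
  then obtain a where a: "\<And>c. c < n \<Longrightarrow> a c < 2 ^ l"
      "\<And>c. c < n \<Longrightarrow> \<bar>2 * real (3 * a c + 1) / (3 * 2 ^ l) - 1 - y c\<bar> \<le> 2 / 2 ^ l"
    by metis
  \<comment> \<open>The face coordinate \<open>c0\<close> has no digit, so the later coordinates
    move down by one place.\<close>
  define a' where "a' = (\<lambda>j. a (if j < c0 then j else Suc j))"
  have "a' j < b" if "j < n - 1" for j
    using that a(1) by (auto simp: a'_def b_def)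
  then obtain h where h: "h div M = h0 div M" "\<And>j. j < n - 1 \<Longrightarrow> h div b ^ j mod b = a' j"
    using exists_digits[of "n - 1" a' b "h0 div M"] unfolding M_def by blast
  \<comment> \<open>Both thresholds of level \<open>l\<close> are multiples of \<open>M\<close>, so
    lying between them depends only on the quotient by \<open>M\<close>, which \<open>h\<close> and
    \<open>h0\<close> share.\<close>
  have pow: "2 ^ (n * l) = 2 ^ l * M" "2 ^ (n * Suc l) = 2 ^ (l + n) * M"
  proof -
    have "n * l = l + l * (n - 1)" "n * Suc l = l + n + l * (n - 1)"
      using n by (cases n; simp)+
    then show "2 ^ (n * l) = 2 ^ l * M" "2 ^ (n * Suc l) = 2 ^ (l + n) * M"
      by (simp_all only: M_def b_def power_add power_mult mult.assoc)
  qed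
  have "2 ^ (n * l) \<le> h0" "h0 < 2 ^ (n * Suc l)"
    unfolding h0_def l_def
    by (auto intro: two_power_level_le less_two_power_level[OF n] simp del: mult_Suc_right)
  then have "2 ^ l \<le> h0 div M" "h0 div M < 2 ^ (l + n)"
    unfolding pow using \<open>M > 0\<close> by (auto simp: less_eq_div_iff_mult_less_eq div_less_iff_less_mult)
  then have "2 ^ (n * l) \<le> h" "h < 2 ^ (n * Suc l)"
    unfolding pow h(1)[symmetric] using \<open>M > 0\<close>
    by (auto simp: less_eq_div_iff_mult_less_eq div_less_iff_less_mult)
  have "h > 0"
    using \<open>2 ^ (n * l) \<le> h\<close> by (rule less_le_trans[rotated]) simp
  define k where "k = 2 * n * (h - 1) + f"
  have k: "Suc (k div (2 * n)) = h" "k mod (2 * n) = f"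
    using f(1) \<open>h > 0\<close> n by (auto simp: k_def)
  have lev: "level n k = l"
    using \<open>2 ^ (n * l) \<le> h\<close> \<open>h < 2 ^ (n * Suc l)\<close> unfolding k(1)[symmetric]
    by (rule level_eqI[OF n])
  have "\<bar>cube_coord n k c - y c\<bar> \<le> 2 / 2 ^ l" if "c < n" for c
  proof (cases "c = c0")
    case True
    have "cube_coord n k c = y c"
      using c0(2) f(2) True by (auto simp: cube_coord_def cube_num_def Let_def k(2) lev f_def)
    then show ?thesis
      by simp
  next
    case False
    define j where "j = (if c < c0 then c else c - 1)"
    have "j < n - 1"
      using False that c0(1) by (auto simp: j_def)
    have "digit n k j = a' j"
      using h(2)[OF \<open>j < n - 1\<close>] by (simp add: digit_def k(1) lev b_def)
    also have "\<dots> = a c"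
      using False by (auto simp: a'_def j_def)
    finally have "cube_num n k c = 3 * a c + 1"
      using False by (simp add: cube_num_def Let_def k(2) f(2) j_def)
    then show ?thesis
      unfolding cube_coord_def lev using a(2)[OF that] by simp
  qed
  moreover have "\<bar>real k - real k0\<bar> \<le> 2 * real n * 2 ^ (l * (n - 1))"
  proof -
    have "h = h0 div M * M + h mod M" "h0 = h0 div M * M + h0 mod M" "h mod M < M" "h0 mod M < M"
      using \<open>M > 0\<close> h(1) by (metis div_mult_mod_eq) (use \<open>M > 0\<close> in auto)
    then have "h \<le> h0 + (M - 1)" "h0 \<le> h + (M - 1)"
      by linarith+
    have k0: "k0 = 2 * n * (h0 - 1) + k0 mod (2 * n)" "k0 mod (2 * n) < 2 * n"
      using n by (auto simp: h0_def)
    have "2 * n * (h - 1) \<le> 2 * n * (h0 - 1 + (M - 1))" "2 * n * (h0 - 1) \<le> 2 * n * (h - 1 + (M - 1))"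
      using \<open>h \<le> h0 + (M - 1)\<close> \<open>h0 \<le> h + (M - 1)\<close> by (intro mult_left_mono; simp)+
    then have *: "2 * n * (h - 1) \<le> 2 * n * (h0 - 1) + 2 * n * (M - 1)"
        "2 * n * (h0 - 1) \<le> 2 * n * (h - 1) + 2 * n * (M - 1)"
      by (simp_all only: add_mult_distrib2)
    have "2 * n * M = 2 * n * (M - 1) + 2 * n"
      using \<open>M > 0\<close> by (cases M) auto
    then have "k \<le> k0 + 2 * n * M" "k0 \<le> k + 2 * n * M"
      using k0 f(1) * unfolding k_def by linarith+
    then have "real k \<le> real (k0 + 2 * n * M)" "real k0 \<le> real (k + 2 * n * M)"
      by (simp_all only: of_nat_le_iff)
    then have "\<bar>real k - real k0\<bar> \<le> real (2 * n * M)"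
      by linarith
    also have "real (2 * n * M) = 2 * real n * 2 ^ (l * (n - 1))"
      by (simp add: M_def b_def flip: power_mult)
    finally show ?thesis .
  qed
  ultimately show ?thesis
    using lev unfolding l_def by blast
qed

section \<open>Computability of the projected nets\<close>

text \<open>All coordinates of one point have the same denominator \<open>B k\<close>, which cancels
  in the quotient; what remains is an integer over the square root of a positive natural
  number.\<close>

lemma computable_real_seq_cube_coord:
  assumes n: "n > 0" and i: "i < n"
  shows "computable_real_seq (\<lambda>k. cube_coord n k i / sqrt (\<Sum>c<n. (cube_coord n k c)\<^sup>2))"
proof -
  have h: "rec_fun m (\<lambda>xs. Suc (xs ! j div (2 * n)))" if "j < m" for m j
    using that by (intro rec_fun_Suc rec_fun_div rec_fun_const rec_fun_proj)
  define F :: "nat list \<Rightarrow> nat"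
    where "F = (\<lambda>xs. if Suc (xs ! 1 div (2 * n)) < 2 ^ (n * Suc (xs ! 0)) then 0 else 1)"
  have "rec_fun (Suc 1) F"
    unfolding F_def
    by (intro rec_fun_if_less rec_fun_power rec_fun_mult rec_fun_Suc rec_fun_div rec_fun_const
        rec_fun_proj) auto
  then have "rec_fun 1 (\<lambda>xs. LEAST y. F (y # xs) = 0)"
    by (rule rec_fun_Least) (use less_two_power_level[OF n] in \<open>auto simp: F_def\<close>)
  then have level: "rec_fun 1 (\<lambda>xs. level n (xs ! 0))"
    by (rule rec_fun_cong) (simp add: F_def level_def)
  have digit: "rec_fun 1 (\<lambda>xs. digit n (xs ! 0) j)" for j
    unfolding digit_def
    by (intro rec_fun_mod rec_fun_div rec_fun_power rec_fun_const level h) auto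
  have f: "rec_fun 1 (\<lambda>xs. xs ! 0 mod (2 * n) mod 2)" "rec_fun 1 (\<lambda>xs. xs ! 0 mod (2 * n) div 2)"
    by (intro rec_fun_mod rec_fun_div rec_fun_const rec_fun_proj; simp)+
  \<comment> \<open>The case distinction is pulled out of the index of \<open>digit\<close>, so that
    every branch uses a fixed index.\<close>
  have num: "rec_fun 1 (\<lambda>xs. let f = xs ! 0 mod (2 * n) in
     if c = f div 2 then if f mod 2 = 0 then 0 else 3 * 2 ^ level n (xs ! 0)
     else 3 * (if c < f div 2 then digit n (xs ! 0) c else digit n (xs ! 0) (c - 1)) + 1)" for c
    unfolding Let_def
    by (intro rec_fun_if_less rec_fun_if_eq rec_fun_add rec_fun_mult rec_fun_power rec_fun_const
        level digit f)
  have num: "rec_fun 1 (\<lambda>xs. 2 * cube_num n (xs ! 0) c)" for c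
    by (intro rec_fun_mult rec_fun_const rec_fun_cong[OF num[of c]]) (simp add: cube_num_def Let_def)
  have b: "rec_fun 1 (\<lambda>xs. 3 * 2 ^ level n (xs ! 0))"
    by (intro rec_fun_mult rec_fun_power rec_fun_const level)
  define B where "B = (\<lambda>k. 3 * 2 ^ level n k :: nat)"
  define d where "d = (\<lambda>k c. 2 * cube_num n k c - B k + (B k - 2 * cube_num n k c))"
  define q where "q = (\<lambda>k. \<Sum>c<n. d k c ^ 2)"
  have q: "rec_fun 1 (\<lambda>xs. q (xs ! 0))"
    unfolding q_def d_def B_def
    by (intro rec_fun_sum rec_fun_power rec_fun_add rec_fun_diff rec_fun_const num b)
  have B: "real (B k) > 0" for k
    by (simp add: B_def)
  have num_eq: "2 * real (cube_num n k c) - real (B k) = B k * cube_coord n k c" for k c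
    by (simp add: cube_coord_def B_def field_simps)
  have "real (d k c) ^ 2 = (2 * real (cube_num n k c) - real (B k)) ^ 2" for k c
  proof (cases "2 * cube_num n k c \<le> B k")
    case True
    then have "real (d k c) = real (B k) - 2 * real (cube_num n k c)"
      by (simp add: d_def of_nat_diff)
    then show ?thesis
      by (simp add: power2_commute)
  qed (simp add: d_def of_nat_diff)
  then have q_eq: "real (q k) = (B k)\<^sup>2 * (\<Sum>c<n. (cube_coord n k c)\<^sup>2)" for k
    by (simp add: q_def num_eq power_mult_distrib sum_distrib_left)
  have "(\<Sum>c<n. (cube_coord n k c)\<^sup>2) > 0" for k
  proof -
    have "cube_coord n k (k mod (2 * n) div 2) \<noteq> 0"
      using abs_cube_coord_face[of n k] by auto
    then show ?thesis
      using face_less[OF n, of k] by (intro sum_pos2[of _ "k mod (2 * n) div 2"]) auto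
  qed
  then have "real (q k) > 0" for k
    unfolding q_eq using B[of k] by simp
  then have "computable_real_seq (\<lambda>k. (real (2 * cube_num n k i) - real (B k)) / sqrt (q k))"
    using b by (intro computable_real_seq_div_sqrt num q) (auto simp: B_def)
  also have "(\<lambda>k. (real (2 * cube_num n k i) - real (B k)) / sqrt (q k)) =
      (\<lambda>k. cube_coord n k i / sqrt (\<Sum>c<n. (cube_coord n k c)\<^sup>2))"
  proof
    fix k
    show "(real (2 * cube_num n k i) - real (B k)) / sqrt (q k) =
        cube_coord n k i / sqrt (\<Sum>c<n. (cube_coord n k c)\<^sup>2)"
      using B[of k] by (simp add: q_eq num_eq real_sqrt_mult)
  qed
  finally show ?thesis .
qed

section \<open>Comparison of the cube with the sphere\<close>

text \<open>Multiplied by \<open>norm x\<close>, the difference of the directions is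
  \<open>x - y\<close> plus a multiple of \<open>sgn y\<close> of length at most
  \<open>norm (x - y)\<close>.\<close>

lemma norm_sgn_diff_le:
  fixes x y :: "'a::real_normed_vector"
  assumes "x \<noteq> 0"
  shows "norm (sgn x - sgn y) \<le> 2 * norm (x - y) / norm x"
proof -
  have "norm x *\<^sub>R (sgn x - sgn y) = (x - y) + (norm y - norm x) *\<^sub>R sgn y"
    using assms by (cases "y = 0") (auto simp: sgn_div_norm algebra_simps)
  then have "norm x * norm (sgn x - sgn y) = norm ((x - y) + (norm y - norm x) *\<^sub>R sgn y)"
    by (metis norm_scaleR abs_norm_cancel)
  also have "\<dots> \<le> norm (x - y) + \<bar>norm y - norm x\<bar> * 1"
    by (rule norm_triangle_le) (auto simp: norm_sgn)
  also have "\<dots> \<le> 2 * norm (x - y)"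
    using norm_triangle_ineq3[of y x] by (simp add: norm_minus_commute)
  finally show ?thesis
    using assms by (simp add: pos_le_divide_eq mult.commute)
qed

text \<open>On the cube surface \<open>infnorm (sgn z) = 1 / norm z\<close>, so close directions
  have close norms. Then \<open>x - y\<close> splits into a part from the directions and a part from
  the norms.\<close>

lemma norm_diff_le_norm_sgn_diff:
  fixes x y :: "'a::euclidean_space"
  assumes x: "infnorm x = 1" and y: "infnorm y = 1"
  shows "norm (x - y) \<le> 2 * DIM('a) * norm (sgn x - sgn y)"
proof -
  have le: "1 \<le> norm z" "norm z \<le> sqrt DIM('a)" if "infnorm z = 1" for z :: 'a
    using infnorm_le_norm[of z] norm_le_infnorm[of z] that by auto
  have "infnorm (sgn z) = 1 / norm z" if "infnorm z = 1" for z :: 'a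
    using that by (simp add: sgn_div_norm infnorm_mul divide_inverse)
  from this[OF x] this[OF y]
  have "norm x - norm y = norm x * norm y * (infnorm (sgn y) - infnorm (sgn x))"
    using le(1)[OF x] le(1)[OF y]
    by (cases "x = 0"; cases "y = 0") (simp_all add: right_diff_distrib)
  then have "\<bar>norm x - norm y\<bar> = norm x * norm y * \<bar>infnorm (sgn y) - infnorm (sgn x)\<bar>"
    by (simp add: abs_mult)
  also have "\<dots> \<le> sqrt DIM('a) * sqrt DIM('a) * norm (sgn x - sgn y)"
    using le[OF x] le[OF y] absdiff_infnorm[of "sgn y" "sgn x"] infnorm_le_norm[of "sgn y - sgn x"]
    by (intro mult_mono) (auto simp: norm_minus_commute)
  finally have 1: "\<bar>norm x - norm y\<bar> \<le> DIM('a) * norm (sgn x - sgn y)"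
    by simp
  have "1 \<le> sqrt DIM('a)"
    using DIM_positive[where 'a='a] by simp
  from mult_right_mono[OF this, of "sqrt DIM('a)"] have "norm x \<le> DIM('a)"
    using le(2)[OF x] by simp
  have sc: "norm z *\<^sub>R sgn z = z" for z :: 'a
    by (cases "z = 0") (auto simp: sgn_div_norm)
  have "x - y = norm x *\<^sub>R (sgn x - sgn y) + (norm x - norm y) *\<^sub>R sgn y"
    by (simp add: sc algebra_simps)
  then have "norm (x - y) \<le> norm x * norm (sgn x - sgn y) + \<bar>norm x - norm y\<bar> * 1"
    by (auto simp: norm_sgn intro: norm_triangle_le)
  also have "\<dots> \<le> DIM('a) * norm (sgn x - sgn y) + DIM('a) * norm (sgn x - sgn y)"
    using 1 \<open>norm x \<le> DIM('a)\<close> by (intro add_mono mult_right_mono) auto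
  finally show ?thesis
    by simp
qed

lemma norm_scaleR_diff_ge_radial:
  fixes u v :: "'a::real_normed_vector"
  assumes "norm u = 1" "norm v = 1" "0 \<le> r" "0 \<le> s"
  shows "s - r \<le> norm (r *\<^sub>R u - s *\<^sub>R v)"
  using norm_triangle_ineq2[of "s *\<^sub>R v" "r *\<^sub>R u"] assms by (simp add: norm_minus_commute)

text \<open>The squares of the two sides differ by
  \<open>(s - r)\<^sup>2 + 2 * r * (s - r) * (1 - u \<bullet> v)\<close>, which is nonnegative by
  the Cauchy-Schwarz inequality.\<close>

lemma norm_scaleR_diff_ge_angular:
  fixes u v :: "'a::real_inner"
  assumes "norm u = 1" "norm v = 1" "0 \<le> r" "r \<le> s"
  shows "r * norm (u - v) \<le> norm (r *\<^sub>R u - s *\<^sub>R v)"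
proof (rule power2_le_imp_le)
  have uv: "u \<bullet> u = 1" "v \<bullet> v = 1"
    using assms by (auto simp: norm_eq_1)
  have "(norm (r *\<^sub>R u - s *\<^sub>R v))\<^sup>2 = r\<^sup>2 + s\<^sup>2 - 2 * r * s * (u \<bullet> v)"
    unfolding power2_norm_eq_inner
    by (simp add: inner_diff_left inner_diff_right inner_commute[of v u] uv power2_eq_square
        algebra_simps)
  also have "\<dots> = r\<^sup>2 * (2 - 2 * (u \<bullet> v)) + ((s - r)\<^sup>2 + 2 * r * (s - r) * (1 - u \<bullet> v))"
    by (simp add: power2_eq_square algebra_simps)
  also have "\<dots> \<ge> r\<^sup>2 * (2 - 2 * (u \<bullet> v))"
    using assms norm_cauchy_schwarz[of u v] by simp
  also have "2 - 2 * (u \<bullet> v) = (norm (u - v))\<^sup>2"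
    unfolding power2_norm_eq_inner
    by (simp add: inner_diff_left inner_diff_right inner_commute[of v u] uv)
  finally show "(r * norm (u - v))\<^sup>2 \<le> (norm (r *\<^sub>R u - s *\<^sub>R v))\<^sup>2"
    by (simp add: power_mult_distrib)
qed simp

section \<open>Radii, their powers and levels\<close>

lemma power_diff_le:
  fixes a b :: real
  assumes "0 \<le> a" "a \<le> b"
  shows "b ^ n - a ^ n \<le> n * b ^ (n - 1) * (b - a)"
proof -
  have "(\<Sum>i<n. a ^ (n - Suc i) * b ^ i) \<le> (\<Sum>i<n. b ^ (n - 1))"
  proof (rule sum_mono)
    fix i assume "i \<in> {..<n}"
    then have "b ^ (n - 1) = b ^ (n - Suc i) * b ^ i"
      by (simp flip: power_add)
    then show "a ^ (n - Suc i) * b ^ i \<le> b ^ (n - 1)"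
      using assms by (auto intro!: mult_right_mono power_mono)
  qed
  then have "(b - a) * (\<Sum>i<n. a ^ (n - Suc i) * b ^ i) \<le> (b - a) * (n * b ^ (n - 1))"
    using assms by (intro mult_left_mono) auto
  then show ?thesis
    by (simp add: power_diff_sumr2 mult_ac)
qed

text \<open>Of the sum that factors the difference of powers, the single term
  \<open>b ^ (n - 1)\<close> is kept. This bounds a change of radius by the change of index.\<close>

lemma abs_diff_mult_power_le:
  fixes a b :: real
  assumes "0 \<le> a" "0 \<le> b" "n > 0"
  shows "\<bar>a - b\<bar> * b ^ (n - 1) \<le> \<bar>a ^ n - b ^ n\<bar>"
proof -
  have "b ^ (n - 1) = (\<Sum>i\<in>{0}. b ^ (n - Suc i) * a ^ i)"
    by simp
  also have "\<dots> \<le> (\<Sum>i<n. b ^ (n - Suc i) * a ^ i)"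
    using assms by (intro sum_mono2) auto
  finally show ?thesis
    unfolding power_diff_sumr2[of a] abs_mult by (intro mult_left_mono) auto
qed

text \<open>Roots are taken of \<open>2 ^ (n * l) \<le> 2 * k\<close> and
  \<open>k < 2 ^ (n * Suc l) * (2 * n)\<close>; the factors 2 and \<open>2 * n\<close> are absorbed
  by their own \<open>n\<close>-th powers.\<close>

lemma root_level_bounds:
  assumes n: "n > 0" and k: "k \<ge> 1"
  shows "2 ^ level n k / 2 \<le> root n (real k)"
    and "root n (real k) \<le> 4 * real n * 2 ^ level n k"
proof -
  define l where "l = level n k"
  have "2 ^ (n * l) \<le> Suc (k div (2 * n))"
    unfolding l_def by (rule two_power_level_le)
  also have "\<dots> \<le> 2 * k"
    using k div_le_dividend[of k "2 * n"] by linarith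
  finally have "real (2 ^ (n * l)) \<le> real (2 * k)"
    by (simp only: of_nat_le_iff)
  then have "2 ^ (n * l) / 2 \<le> real k"
    by simp
  moreover have "(2 ^ l / 2) ^ n = 2 ^ (n * l) / (2 ^ n :: real)"
    by (simp add: power_divide mult.commute[of n] flip: power_mult)
  moreover have "\<dots> \<le> 2 ^ (n * l) / 2"
    using n self_le_power[of "2::real" n] by (intro divide_left_mono) auto
  ultimately have "(2 ^ l / 2) ^ n \<le> real k"
    by linarith
  then have "root n ((2 ^ l / 2) ^ n) \<le> root n (real k)"
    using n by (rule real_root_le_mono[rotated])
  then show "2 ^ level n k / 2 \<le> root n (real k)"
    using n by (simp add: l_def real_root_power_cancel)
  have "k div (2 * n) < 2 ^ (n * Suc l)"
    using less_two_power_level[OF n, of k] by (simp add: l_def)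
  then have "k < 2 ^ (n * Suc l) * (2 * n)"
    using n by (subst (asm) div_less_iff_less_mult) auto
  also have "\<dots> \<le> 2 ^ (n * Suc l) * (2 * n) ^ n"
    using n self_le_power[of "2 * n" n] by (intro mult_left_mono) auto
  also have "\<dots> = (2 ^ Suc l * (2 * n)) ^ n"
    unfolding power_mult_distrib power_mult[symmetric] by (simp add: mult.commute)
  finally have "real k \<le> real ((2 ^ Suc l * (2 * n)) ^ n)"
    by (simp only: of_nat_le_iff)
  then have "real k \<le> (4 * real n * 2 ^ l) ^ n"
    by (simp add: mult_ac)
  then have "root n (real k) \<le> root n ((4 * real n * 2 ^ l) ^ n)"
    using n by simp
  then show "root n (real k) \<le> 4 * real n * 2 ^ level n k"
    using n by (simp add: l_def real_root_power_cancel)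
qed

section \<open>The spiral set\<close>

text \<open>The index type \<open>'n\<close> carries no numbering of its own, so \<open>e\<close>
  supplies one.\<close>

definition cube_vec :: "('n \<Rightarrow> nat) \<Rightarrow> nat \<Rightarrow> real ^ 'n" where
  "cube_vec e k = (\<chi> i. cube_coord CARD('n) k (e i))"

lemma infnorm_cube_vec:
  fixes e :: "'n::finite \<Rightarrow> nat"
  assumes e: "bij_betw e UNIV {..<CARD('n)}"
  shows "infnorm (cube_vec e k) = 1"
proof (rule antisym)
  show "infnorm (cube_vec e k) \<le> 1"
    unfolding infnorm_cart by (rule cSup_least) (auto simp: cube_vec_def abs_cube_coord_le)
  have "k mod (2 * CARD('n)) div 2 \<in> e ` UNIV"
    using face_less[of "CARD('n)" k] e by (simp add: bij_betw_def)
  then obtain i where "e i = k mod (2 * CARD('n)) div 2"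
    by auto
  then have "\<bar>cube_vec e k $ i\<bar> = 1"
    by (simp add: cube_vec_def abs_cube_coord_face)
  then show "1 \<le> infnorm (cube_vec e k)"
    using component_le_infnorm_cart[of "cube_vec e k" i] by simp
qed

lemma norm_sgn_cube_vec:
  fixes e :: "'n::finite \<Rightarrow> nat"
  assumes "bij_betw e UNIV {..<CARD('n)}"
  shows "norm (sgn (cube_vec e k)) = 1"
  using infnorm_cube_vec[OF assms, of k] by (auto simp: norm_sgn infnorm_0)

lemma computable_vec_seq_sgn_cube_vec:
  fixes e :: "'n::finite \<Rightarrow> nat"
  assumes e: "bij_betw e UNIV {..<CARD('n)}"
  shows "computable_vec_seq (\<lambda>k. sgn (cube_vec e k))"
  unfolding computable_vec_seq_def
proof
  fix i
  have "sgn (cube_vec e k) $ i =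
      cube_coord CARD('n) k (e i) / sqrt (\<Sum>c<CARD('n). (cube_coord CARD('n) k c)\<^sup>2)" for k
    using sum.reindex_bij_betw[OF e, of "\<lambda>c. (cube_coord CARD('n) k c)\<^sup>2"]
    by (simp add: sgn_div_norm norm_vec_def L2_set_def cube_vec_def divide_inverse mult.commute)
  moreover have "e i < CARD('n)"
    using e by (auto simp: bij_betw_def)
  ultimately show "computable_real_seq (\<lambda>k. sgn (cube_vec e k) $ i)"
    using computable_real_seq_cube_coord[of "CARD('n)" "e i"] by simp
qed

section \<open>Separation and density of the spiral points\<close>

text \<open>A large index gap \<open>k' - k = r' ^ n - r ^ n\<close> forces a radial gap, as
  \<open>r'\<close> is at most \<open>4 * N * 2 ^ l'\<close>. Otherwise the directions differ by at
  least \<open>1 / (6 * N * 2 ^ l)\<close>, seen at radius at least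
  \<open>2 ^ l / 2\<close>.\<close>

lemma spiral_separated:
  fixes e :: "'n::finite \<Rightarrow> nat"
  assumes e: "bij_betw e UNIV {..<CARD('n)}" and n: "CARD('n) \<ge> 2" and k: "1 \<le> k" "k < k'"
  defines "N \<equiv> real CARD('n)"
  shows "min (1 / (N * (8 * N) ^ (CARD('n) - 1))) (1 / (12 * N)) \<le>
    dist (root CARD('n) k *\<^sub>R sgn (cube_vec e k)) (root CARD('n) k' *\<^sub>R sgn (cube_vec e k'))"
proof -
  let ?n = "CARD('n)"
  define r r' where "r = root ?n k" and "r' = root ?n k'"
  define l l' where "l = level ?n k" and "l' = level ?n k'"
  let ?d = "dist (r *\<^sub>R sgn (cube_vec e k)) (r' *\<^sub>R sgn (cube_vec e k'))"
  have "N \<ge> 2"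
    using n by (simp add: N_def)
  have r: "0 \<le> r" "0 \<le> r'" "r \<le> r'" "r ^ ?n = k" "r' ^ ?n = k'"
    using k by (auto simp: r_def r'_def)
  have bounds: "2 ^ l / 2 \<le> r" "r' \<le> 4 * N * 2 ^ l'"
    using root_level_bounds[of ?n k] root_level_bounds[of ?n k'] k
    by (auto simp: r_def r'_def l_def l'_def N_def)
  note unit = norm_sgn_cube_vec[OF e]
  consider "2 ^ (l' * (?n - 1)) \<le> 2 ^ (?n - 1) * (k' - k)"
    | c where "l \<le> l'" "l' \<le> Suc l" "c < ?n" "cube_coord ?n k c \<noteq> cube_coord ?n k' c"
    using cube_coord_dichotomy[OF n k(2)] unfolding l_def l'_def by blast
  then show ?thesis
  proof cases
    case 1
    then have "real (2 ^ (l' * (?n - 1))) \<le> real (2 ^ (?n - 1) * (k' - k))"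
      by (simp only: of_nat_le_iff)
    then have "2 ^ (l' * (?n - 1)) \<le> 2 ^ (?n - 1) * (real k' - real k)"
      using k by (simp add: of_nat_diff)
    also have "\<dots> = 2 ^ (?n - 1) * (r' ^ ?n - r ^ ?n)"
      by (simp add: r)
    also have "\<dots> \<le> 2 ^ (?n - 1) * (N * r' ^ (?n - 1) * (r' - r))"
      unfolding N_def using r by (intro mult_left_mono power_diff_le) auto
    also have "\<dots> \<le> 2 ^ (?n - 1) * (N * (4 * N * 2 ^ l') ^ (?n - 1) * (r' - r))"
      using r bounds \<open>N \<ge> 2\<close> by (intro mult_left_mono mult_right_mono power_mono) auto
    \<comment> \<open>The power of \<open>2 ^ l'\<close> is split off to cancel against the
      left-hand side, which leaves a bound independent of the level.\<close>
    also have "\<dots> = 2 ^ (l' * (?n - 1)) * (N * (2 * (4 * N)) ^ (?n - 1) * (r' - r))"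
      unfolding power_mult power_mult_distrib by (simp only: mult_ac)
    finally have "1 \<le> N * (8 * N) ^ (?n - 1) * (r' - r)"
      by simp
    then have "1 / (N * (8 * N) ^ (?n - 1)) \<le> r' - r"
      using \<open>N \<ge> 2\<close> by (simp add: pos_divide_le_eq mult.commute)
    also have "\<dots> \<le> ?d"
      unfolding dist_norm using unit r by (intro norm_scaleR_diff_ge_radial) auto
    finally show ?thesis
      unfolding r_def r'_def by (rule min.coboundedI1)
  next
    case 2
    have "c \<in> range e"
      using e \<open>c < ?n\<close> by (simp add: bij_betw_def)
    then obtain i where i: "e i = c"
      by auto
    \<comment> \<open>Since the levels differ by at most one, the finer spacing is comparable with
      \<open>2 ^ l\<close>, and thus with the smaller radius.\<close>
    have "(2::real) ^ l' \<le> 2 ^ Suc l"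
      using 2 by (intro power_increasing) auto
    then have "1 / (3 * 2 ^ l) \<le> 2 / (3 * (2::real) ^ l')"
      by (simp add: field_simps)
    also have "\<dots> \<le> \<bar>cube_coord ?n k c - cube_coord ?n k' c\<bar>"
      using 2 unfolding l'_def l_def by (intro abs_cube_coord_diff_ge)
    also have "\<dots> = \<bar>(cube_vec e k - cube_vec e k') $ i\<bar>"
      by (simp add: cube_vec_def i)
    also have "\<dots> \<le> norm (cube_vec e k - cube_vec e k')"
      by (rule component_le_norm_cart)
    also have "\<dots> \<le> 2 * N * norm (sgn (cube_vec e k) - sgn (cube_vec e k'))"
      using norm_diff_le_norm_sgn_diff[OF infnorm_cube_vec[OF e] infnorm_cube_vec[OF e]]
      by (simp add: N_def)
    finally have "1 / (3 * 2 ^ l) / (2 * N) \<le> norm (sgn (cube_vec e k) - sgn (cube_vec e k'))"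
      using \<open>N \<ge> 2\<close> by (simp add: pos_divide_le_eq mult_ac)
    then have "2 ^ l / 2 * (1 / (3 * 2 ^ l) / (2 * N)) \<le>
        r * norm (sgn (cube_vec e k) - sgn (cube_vec e k'))"
      using bounds r \<open>N \<ge> 2\<close> by (intro mult_mono) auto
    also have "\<dots> \<le> ?d"
      unfolding dist_norm using unit r by (intro norm_scaleR_diff_ge_angular) auto
    also have "2 ^ l / 2 * (1 / (3 * 2 ^ l) / (2 * N)) = 1 / (12 * N)"
      by simp
    finally show ?thesis
      unfolding r_def r'_def by (rule min.coboundedI2)
  qed
qed

text \<open>An index \<open>k0\<close> whose radius is close to \<open>norm x\<close> fixes the
  level; within one period some \<open>k\<close> of this level has nearly the direction of
  \<open>x\<close>. The three summands bound the error of \<open>r0\<close>, the move from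
  \<open>k0\<close> to \<open>k\<close>, and the angular error.\<close>

lemma spiral_dense:
  fixes e :: "'n::finite \<Rightarrow> nat" and x :: "real ^ 'n"
  assumes e: "bij_betw e UNIV {..<CARD('n)}" and "x \<noteq> 0"
  defines "N \<equiv> real CARD('n)"
  shows "\<exists>k. dist x (root CARD('n) k *\<^sub>R sgn (cube_vec e k)) \<le>
    1 + 2 * N * 2 ^ (CARD('n) - 1) + 16 * N\<^sup>2"
proof -
  let ?n = "CARD('n)"
  have n: "?n > 0" "N \<ge> 1"
    by (simp_all add: N_def Suc_le_eq)
  define y where "y = x /\<^sub>R infnorm x"
  have "infnorm x > 0"
    using \<open>x \<noteq> 0\<close> by (simp add: infnorm_pos_lt)
  then have y: "infnorm y = 1"
    by (simp add: y_def infnorm_mul)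
  have sgn_y: "sgn y = sgn x"
    using \<open>infnorm x > 0\<close> by (simp add: y_def sgn_scaleR)
  have "norm y \<ge> 1"
    using infnorm_le_norm[of y] y by simp
  \<comment> \<open>The maximum is attained, so \<open>y\<close> lies on a face of the cube.\<close>
  have "infnorm y \<in> (\<lambda>i. \<bar>y \<bullet> i\<bar>) ` Basis"
    unfolding infnorm_Max by (intro Max_in) auto
  then obtain i0 where i0: "\<bar>y $ i0\<bar> = 1"
    unfolding y by (auto simp: Basis_vec_def inner_axis)
  define r where "r = norm x"
  \<comment> \<open>Rounding up past \<open>r ^ n\<close> ensures \<open>k0 \<ge> 1\<close> and
    \<open>r \<le> r0\<close>, and overshoots by at most 1, whence
    \<open>r0 \<le> r + 1\<close>.\<close>
  define k0 where "k0 = Suc (nat \<lfloor>r ^ ?n\<rfloor>)"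
  define r0 where "r0 = root ?n k0"
  define l where "l = level ?n k0"
  have "r \<ge> 0"
    by (simp add: r_def)
  have r0: "r0 ^ ?n = k0" "r0 \<ge> 0"
    by (auto simp: r0_def)
  have bounds: "2 ^ l / 2 \<le> r0" "r0 \<le> 4 * N * 2 ^ l"
    using root_level_bounds[of ?n k0] by (auto simp: r0_def l_def N_def k0_def)
  have "r ^ ?n \<le> k0" "k0 \<le> r ^ ?n + 1"
    using zero_le_power[OF \<open>r \<ge> 0\<close>, of ?n] unfolding k0_def by linarith+
  have "r \<le> r0"
    using \<open>r ^ ?n \<le> k0\<close> r0 n(1) by (metis power_mono_iff \<open>r \<ge> 0\<close>)
  have "r0 \<le> r + 1"
  proof -
    have "1 \<le> (r + 1) ^ (?n - 1)"
      using \<open>r \<ge> 0\<close> by simp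
    also have "\<dots> \<le> \<bar>r ^ ?n - (r + 1) ^ ?n\<bar>"
      using abs_diff_mult_power_le[of r "r + 1" ?n] \<open>r \<ge> 0\<close> n(1) by simp
    also have "\<dots> = (r + 1) ^ ?n - r ^ ?n"
      using power_mono[of r "r + 1" ?n] \<open>r \<ge> 0\<close> by simp
    finally have "r0 ^ ?n \<le> (r + 1) ^ ?n"
      using \<open>k0 \<le> r ^ ?n + 1\<close> r0 by simp
    then show ?thesis
      using r0(2) n(1) \<open>r \<ge> 0\<close> by (subst (asm) power_mono_iff) auto
  qed
  define f where "f = the_inv e"
  have f: "f (e i) = i" for i
    using e by (simp add: f_def bij_betw_def the_inv_f_f)
  have ei: "e i < ?n" for i
    using e by (auto simp: bij_betw_def)
  have "\<bar>y $ i\<bar> \<le> 1" for i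
    using component_le_infnorm_cart[of y i] y by simp
  moreover have "\<bar>y $ f (e i0)\<bar> = 1"
    by (simp add: f i0)
  ultimately obtain k where lev: "level ?n k = l"
    and k: "\<bar>real k - real k0\<bar> \<le> 2 * N * 2 ^ (l * (?n - 1))"
    and coord: "\<And>c. c < ?n \<Longrightarrow> \<bar>cube_coord ?n k c - y $ f c\<bar> \<le> 2 / 2 ^ l"
    using cube_coord_dense[of ?n "\<lambda>c. y $ f c" "e i0" k0] n ei unfolding l_def N_def by blast
  define s where "s = root ?n k"
  let ?u = "sgn (cube_vec e k)"
  have s: "s \<ge> 0" "s ^ ?n = k"
    by (auto simp: s_def)
  \<comment> \<open>One period has \<open>2 * N * 2 ^ (l * (?n - 1))\<close> indices, and
    \<open>r0\<close> is at least \<open>2 ^ l / 2\<close>; the powers of \<open>2 ^ l\<close>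
    cancel.\<close>
  have "\<bar>s - r0\<bar> * (2 ^ l / 2) ^ (?n - 1) \<le> \<bar>s - r0\<bar> * r0 ^ (?n - 1)"
    using bounds by (intro mult_left_mono power_mono) auto
  also have "\<dots> \<le> \<bar>s ^ ?n - r0 ^ ?n\<bar>"
    using s r0 n by (intro abs_diff_mult_power_le) auto
  also have "\<dots> \<le> 2 * N * 2 ^ (l * (?n - 1))"
    using k by (simp add: s r0)
  also have "\<dots> = 2 * N * 2 ^ (?n - 1) * (2 ^ l / 2) ^ (?n - 1)"
    by (simp add: power_divide power_mult)
  finally have s_r0: "\<bar>s - r0\<bar> \<le> 2 * N * 2 ^ (?n - 1)"
    by (rule mult_right_le_imp_le) simp
  have "norm (y - cube_vec e k) \<le> (\<Sum>i\<in>UNIV. \<bar>(y - cube_vec e k) $ i\<bar>)"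
    by (rule norm_le_l1_cart)
  also have "\<dots> \<le> (\<Sum>i\<in>(UNIV :: 'n set). 2 / 2 ^ l)"
  proof (rule sum_mono)
    fix i
    show "\<bar>(y - cube_vec e k) $ i\<bar> \<le> 2 / 2 ^ l"
      using coord[OF ei[of i]] by (simp add: cube_vec_def f abs_minus_commute)
  qed
  finally have "norm (y - cube_vec e k) \<le> 2 * N / 2 ^ l"
    by (simp add: N_def mult.commute)
  have "norm (sgn x - ?u) \<le> 2 * norm (y - cube_vec e k) / norm y"
    unfolding sgn_y[symmetric] using \<open>norm y \<ge> 1\<close> by (intro norm_sgn_diff_le) auto
  also have "\<dots> \<le> 2 * norm (y - cube_vec e k) / 1"
    using \<open>norm y \<ge> 1\<close> by (intro divide_left_mono) auto
  also have "\<dots> \<le> 4 * N / 2 ^ l"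
    using \<open>norm (y - cube_vec e k) \<le> 2 * N / 2 ^ l\<close> by simp
  finally have "r * norm (sgn x - ?u) \<le> (4 * N * 2 ^ l) * (4 * N / 2 ^ l)"
    using \<open>r \<le> r0\<close> bounds(2) \<open>r \<ge> 0\<close> n by (intro mult_mono) auto
  then have ang: "r * norm (sgn x - ?u) \<le> 16 * N\<^sup>2"
    by (simp add: power2_eq_square)
  \<comment> \<open>An angular error at radius \<open>r\<close> and a radial error along
    \<open>?u\<close>.\<close>
  have "x - s *\<^sub>R ?u = r *\<^sub>R (sgn x - ?u) + (r - s) *\<^sub>R ?u"
    using \<open>x \<noteq> 0\<close> by (simp add: r_def sgn_div_norm algebra_simps)
  then have "dist x (s *\<^sub>R ?u) \<le> norm (r *\<^sub>R (sgn x - ?u)) + norm ((r - s) *\<^sub>R ?u)"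
    unfolding dist_norm by (metis norm_triangle_ineq)
  also have "\<dots> = r * norm (sgn x - ?u) + \<bar>r - s\<bar>"
    using \<open>r \<ge> 0\<close> by (simp add: norm_sgn_cube_vec[OF e])
  also have "\<dots> \<le> 16 * N\<^sup>2 + (1 + 2 * N * 2 ^ (?n - 1))"
    using ang s_r0 \<open>r \<le> r0\<close> \<open>r0 \<le> r + 1\<close> by (intro add_mono) linarith+
  finally show ?thesis
    unfolding s_def by (auto simp: algebra_simps)
qed

theorem theorem1p1:
  assumes "CARD('n::finite) \<ge> 2"
  shows "\<exists>u :: nat \<Rightarrow> real ^ 'n.
    (\<forall>k\<ge>1. u k \<in> sphere 0 1) \<and> computable_vec_seq u \<and> Delone (spiral_set u)"
proof -
  let ?n = "CARD('n)"
  obtain e :: "'n \<Rightarrow> nat" where e: "bij_betw e UNIV {..<?n}"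
    using ex_bij_betw_finite_nat[of "UNIV :: 'n set"] by (auto simp: atLeast0LessThan)
  define u where "u = (\<lambda>k. sgn (cube_vec e k))"
  define p where "p = (\<lambda>k. root ?n (real k) *\<^sub>R u k)"
  have unit: "norm (u k) = 1" for k
    by (simp add: u_def norm_sgn_cube_vec[OF e])
  have set: "spiral_set u = p ` {1..}"
    by (auto simp: spiral_set_def p_def)
  obtain d where d: "d > 0" "\<And>k k'. 1 \<le> k \<Longrightarrow> k < k' \<Longrightarrow> d \<le> dist (p k) (p k')"
    using spiral_separated[OF e assms] assms
    by (intro that[of "min (1 / (real ?n * (8 * real ?n) ^ (?n - 1))) (1 / (12 * real ?n))"])
      (auto simp: p_def u_def)
  have "uniform_discrete (spiral_set u)"
    unfolding uniform_discrete_def set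
  proof (intro exI[of _ d] conjI ballI impI \<open>d > 0\<close>)
    fix x y assume "x \<in> p ` {1..}" "y \<in> p ` {1..}" "dist x y < d"
    then obtain k k' where k: "x = p k" "y = p k'" "1 \<le> k" "1 \<le> k'"
      by auto
    have "\<not> k < k'" "\<not> k' < k"
      using d(2)[of k k'] d(2)[of k' k] k \<open>dist x y < d\<close> by (auto simp: dist_commute)
    then show "x = y"
      using k by simp
  qed
  moreover have "relatively_dense (spiral_set u)"
  proof -
    define C where "C = 1 + 2 * real ?n * 2 ^ (?n - 1) + 16 * (real ?n)\<^sup>2"
    have "C \<ge> 0"
      by (simp add: C_def)
    have "\<exists>k\<ge>1. dist x (p k) \<le> C + 1" for x
    proof -
      have p: "p 0 = 0" "norm (p 1) = 1"
        by (auto simp: p_def unit)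
      obtain k where k: "dist x (p k) \<le> C"
        using spiral_dense[OF e, of x] \<open>C \<ge> 0\<close> p(1) unfolding C_def p_def u_def
        by (cases "x = 0") (metis dist_self, blast)
      \<comment> \<open>The estimate may have produced \<open>k = 0\<close>, that is the origin,
        which need not belong to the spiral set. The point \<open>p 1\<close> at distance 1 from it
        takes over, hence \<open>C + 1\<close>.\<close>
      show ?thesis
      proof (cases "k = 0")
        case True
        then have "dist x (p 1) \<le> C + 1"
          using k p dist_triangle[of x "p 1" 0] by (simp add: dist_norm)
        then show ?thesis
          by blast
      next
        case False
        then show ?thesis
          using k by (intro exI[of _ k]) auto
      qed
    qed
    then have "(INF y\<in>p ` {1..}. ereal (dist x y)) \<le> ereal (C + 1)" for x
      by (meson INF_lower2 atLeast_iff ereal_less_eq(3) imageI)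
    then have "(SUP x. INF y\<in>p ` {1..}. ereal (dist x y)) \<le> ereal (C + 1)"
      by (rule SUP_least)
    then show ?thesis
      unfolding relatively_dense_def set by (rule le_less_trans) simp
  qed
  moreover have "computable_vec_seq u"
    unfolding u_def by (rule computable_vec_seq_sgn_cube_vec[OF e])
  ultimately show ?thesis
    using unit by (intro exI[of _ u]) (simp add: Delone_def)
qed

end
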